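(* Let $n\ge1$ be an integer, let $\theta\in(\frac{2-n}{2},1]$ if $n=1,2$ and $\theta\in[0,1]$ if $n\geq 3$, and assume that $s>\frac{n+4\theta-6}{2}$. Then there is a constant $C=C_n>0$ (indexed by $n$ only) such that $$\Vert\Lambda_\theta(t)g\Vert_{L^\infty(\mathbb{R}^n)}\leq C\,t^{-\frac{n+2(\theta-1)}{2}}\Vert g\Vert_{L^1(\mathbb{R}^n)}+C\,e^{-\frac t4}\Vert g\Vert_{H^s(\mathbb{R}^n)}$$ for all $g\in L^1(\mathbb{R}^n)\cap H^s(\mathbb{R}^n)$ and all $t>0$.
   Context: For $t\geq 0$, $S(t)$ is the Fourier multiplier operator on $\mathbb{R}^n$ with symbol $$m(\xi,t)=e^{-\frac{|\xi|^2t}{2(1+|\xi|^2)}}\,\frac{2(1+|\xi|^2)}{|\xi|^2\sqrt{3+4|\xi|^2}}\,\sin\left(\frac{|\xi|^2\sqrt{3+4|\xi|^2}\,t}{2(1+|\xi|^2)}\right)$$ (equal to $t$ at $\xi=0$), and $\Lambda_\theta(t)=S(t)(I-\Delta)^{-1}(-\Delta)^\theta$, i.e. the Fourier multiplier operator with symbol $m(\xi,t)(1+|\xi|^2)^{-1}|\xi|^{2\theta}$. $H^s(\mathbb{R}^n)$ is the $L^2$-based Sobolev space.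
   Formalization: The constant C may depend on θ and s as well as on n (not on g or t); a constant depending on n only is impossible, e.g. for n=2, θ=1, t=1 as s decreases to 0. *)

theory Defs
  imports "HOL-Analysis.Analysis" "HOL-Probability.Essential_Supremum"
begin

text \<open>
  The Fourier transform of integrable functions in its unitary normalization, so that the
  Sobolev norm below is the \<open>L\<^sup>2\<close> norm for \<open>s = 0\<close>.  As usual for the Bochner integral, the value
  is 0 where the integrand is not integrable.
\<close>

definition fourier :: "(real ^ 'n \<Rightarrow> complex) \<Rightarrow> real ^ 'n \<Rightarrow> complex" where
  "fourier f \<xi> = (2 * pi) powr (- real CARD('n) / 2) *\<^sub>R (LINT x|lebesgue. cis (- (x \<bullet> \<xi>)) * f x)"

definition inv_fourier :: "(real ^ 'n \<Rightarrow> complex) \<Rightarrow> real ^ 'n \<Rightarrow> complex" where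
  "inv_fourier F x = (2 * pi) powr (- real CARD('n) / 2) *\<^sub>R (LINT \<xi>|lebesgue. cis (x \<bullet> \<xi>) * F \<xi>)"

text \<open>
  The Fourier multiplier operator with symbol \<open>\<sigma>\<close>, as an absolutely convergent inverse Fourier
  integral.  It is meaningful for integrable \<open>g\<close> such that \<open>\<sigma> \<cdot> fourier g\<close> is integrable
  (predicate \<open>multiplier_defined\<close>), and then agrees with the operator on tempered distributions.
\<close>

definition multiplier_defined ::
    "(real ^ 'n \<Rightarrow> real) \<Rightarrow> (real ^ 'n \<Rightarrow> complex) \<Rightarrow> bool" where
  "multiplier_defined \<sigma> g \<longleftrightarrow>
     integrable lebesgue g \<and> integrable lebesgue (\<lambda>\<xi>. of_real (\<sigma> \<xi>) * fourier g \<xi>)"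

definition fourier_multiplier ::
    "(real ^ 'n \<Rightarrow> real) \<Rightarrow> (real ^ 'n \<Rightarrow> complex) \<Rightarrow> real ^ 'n \<Rightarrow> complex" where
  "fourier_multiplier \<sigma> g = inv_fourier (\<lambda>\<xi>. of_real (\<sigma> \<xi>) * fourier g \<xi>)"

definition S_symbol :: "real \<Rightarrow> real ^ 'n \<Rightarrow> real" where
  "S_symbol t \<xi> =
     (if \<xi> = 0 then t
      else exp (- ((norm \<xi>)\<^sup>2 * t / (2 * (1 + (norm \<xi>)\<^sup>2))))
           * (2 * (1 + (norm \<xi>)\<^sup>2) / ((norm \<xi>)\<^sup>2 * sqrt (3 + 4 * (norm \<xi>)\<^sup>2)))
           * sin ((norm \<xi>)\<^sup>2 * sqrt (3 + 4 * (norm \<xi>)\<^sup>2) * t / (2 * (1 + (norm \<xi>)\<^sup>2))))"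

text \<open>
  The case distinction is there because \<open>0 powr 0 = 0\<close> in HOL, whereas \<open>(-\<Delta>)\<^sup>0\<close> is the identity.
\<close>

definition Lambda_symbol :: "real \<Rightarrow> real \<Rightarrow> real ^ 'n \<Rightarrow> real" where
  "Lambda_symbol \<theta> t \<xi> =
     S_symbol t \<xi> * inverse (1 + (norm \<xi>)\<^sup>2) * (if \<theta> = 0 then 1 else norm \<xi> powr (2 * \<theta>))"

definition Lambda_op :: "real \<Rightarrow> real \<Rightarrow> (real ^ 'n \<Rightarrow> complex) \<Rightarrow> real ^ 'n \<Rightarrow> complex" where
  "Lambda_op \<theta> t = fourier_multiplier (Lambda_symbol \<theta> t)"

text \<open>
  Membership in \<open>L\<^sup>1 \<inter> H\<^sup>s\<close>, for any real \<open>s\<close>: for an integrable function the distributional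
  Fourier transform in the definition of \<open>H\<^sup>s\<close> is \<open>fourier g\<close>.
\<close>

definition L1_Hs :: "real \<Rightarrow> (real ^ 'n \<Rightarrow> complex) set" where
  "L1_Hs s = {g. integrable lebesgue g \<and>
                 integrable lebesgue (\<lambda>\<xi>. (1 + (norm \<xi>)\<^sup>2) powr s * (norm (fourier g \<xi>))\<^sup>2)}"

definition L1_norm :: "(real ^ 'n \<Rightarrow> complex) \<Rightarrow> real" where
  "L1_norm g = (LINT x|lebesgue. norm (g x))"

definition Hs_norm :: "real \<Rightarrow> (real ^ 'n \<Rightarrow> complex) \<Rightarrow> real" where
  "Hs_norm s g = sqrt (LINT \<xi>|lebesgue. (1 + (norm \<xi>)\<^sup>2) powr s * (norm (fourier g \<xi>))\<^sup>2)"

text \<open>Infinite for essentially unbounded and for non-measurable functions.\<close>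

definition Linf_norm :: "(real ^ 'n \<Rightarrow> complex) \<Rightarrow> ereal" where
  "Linf_norm f = esssup lebesgue (\<lambda>x. ereal (norm (f x)))"

end

theory Submission
  imports Defs
begin

text \<open>
  The frequencies are split at \<open>\<bar>\<xi>\<bar> = 1\<close>.  Below, the symbol is at most
  \<open>2 exp (-\<bar>\<xi>\<bar>\<^sup>2 t / 4) \<bar>\<xi>\<bar>\<^sup>2\<^sup>\<theta>\<^sup>-\<^sup>2\<close>, whose integral over the whole space is a multiple of
  \<open>t powr (-(n + 2 (\<theta> - 1)) / 2)\<close>, and the transform of \<open>g\<close> is bounded by its
  \<open>L\<^sup>1\<close> norm; integrability at the origin is the condition \<open>n + 2\<theta> - 2 > 0\<close>.  Above, the damping
  factor is at most \<open>exp (-t / 4)\<close> and the symbol decays like \<open>\<bar>\<xi>\<bar>\<^sup>2\<^sup>\<theta>\<^sup>-\<^sup>3\<close>, which by Cauchy-Schwarz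
  pairs with the \<open>H\<^sup>s\<close> norm exactly when \<open>4\<theta> - 6 - 2s < -n\<close>.
\<close>

section \<open>Integration of radial functions and of powers of the norm\<close>

text \<open>Polar coordinates without a surface measure. Half-lines \<open>{..u}\<close> form an
  intersection-stable generator, so agreement there suffices: the left side is the volume of a ball
  of radius \<open>u\<close>, the right side the integral of the derivative of that volume.\<close>

lemma distr_norm_lborel:
  "distr (lborel :: 'a::euclidean_space measure) borel norm =
   density lborel (\<lambda>r. ennreal (real DIM('a) * unit_ball_vol (real DIM('a)) * r ^ (DIM('a) - 1))
                        * indicator {0..} r)"
    (is "?M = ?N")
proof (rule measure_eqI_generator_eq[where E = "range atMost" and \<Omega> = UNIV
        and A = "\<lambda>i. {..real i}"])
  let ?v = "unit_ball_vol (real DIM('a))"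
  show "Int_stable (range (atMost :: real \<Rightarrow> real set))"
    by (auto simp: Int_stable_def)
  \<comment> \<open>For \<open>u < 0\<close> the closed ball is empty, hence the case
    distinction.\<close>
  have *: "emeasure ?M {..u} = ennreal (if u < 0 then 0 else ?v * u ^ DIM('a))" for u :: real
  proof -
    have "emeasure ?M {..u} = emeasure lborel (cball (0::'a) u)"
      by (subst emeasure_distr) (auto intro!: arg_cong2[where f = emeasure])
    then show ?thesis
      using emeasure_cball[of u "0::'a"] by (cases "u < 0") auto
  qed
  show "emeasure ?M {..real i} \<noteq> \<infinity>" for i
    by (simp add: *)
  show "emeasure ?M X = emeasure ?N X" if "X \<in> range atMost" for X
  proof -
    from that obtain u where X: "X = {..u}" by auto
    have "emeasure ?N X = (\<integral>\<^sup>+r. ennreal (real DIM('a) * ?v * r ^ (DIM('a) - 1)) * indicator {0..u} r \<partial>lborel)"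
      unfolding X by (subst emeasure_density) (auto intro!: nn_integral_cong simp: indicator_def)
    also have "\<dots> = ennreal (if u < 0 then 0 else ?v * u ^ DIM('a))"
    proof (cases "u < 0")
      case False
      have "(\<integral>\<^sup>+r. ennreal (real DIM('a) * ?v * r ^ (DIM('a) - 1)) * indicator {0..u} r \<partial>lborel)
          = ennreal (?v * u ^ DIM('a) - ?v * 0 ^ DIM('a))"
        using False
        by (intro nn_integral_FTC_Icc) (auto intro!: derivative_eq_intros)
      then show ?thesis using False by simp
    qed (auto simp: indicator_def)
    finally show ?thesis by (simp add: X *)
  qed
  show "sets ?M = sigma_sets UNIV (range atMost)"
    using borel_eq_atMost by (metis sets_distr sets_measure_of top_greatest Pow_UNIV)
  then show "sets ?N = sigma_sets UNIV (range atMost)" by simp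
  show "(\<Union>i. {..real i}) = UNIV"
    by (auto simp: real_arch_simple)
qed auto

lemma nn_integral_radial:
  assumes [measurable]: "f \<in> borel_measurable borel"
  shows "(\<integral>\<^sup>+(x::'a::euclidean_space). f (norm x) \<partial>lborel) =
    ennreal (real DIM('a) * unit_ball_vol (real DIM('a))) *
      (\<integral>\<^sup>+r. ennreal (r ^ (DIM('a) - 1)) * f r * indicator {0..} r \<partial>lborel)"
proof -
  have "(\<integral>\<^sup>+(x::'a). f (norm x) \<partial>lborel) = (\<integral>\<^sup>+r. f r \<partial>distr (lborel :: 'a measure) borel norm)"
    by (simp add: nn_integral_distr)
  also have "\<dots> = (\<integral>\<^sup>+r. ennreal (real DIM('a) * unit_ball_vol (real DIM('a))) *
      (ennreal (r ^ (DIM('a) - 1)) * f r * indicator {0..} r) \<partial>lborel)"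
    unfolding distr_norm_lborel
    by (subst nn_integral_density)
       (auto intro!: nn_integral_cong simp: indicator_def ennreal_mult mult.assoc)
  finally show ?thesis by (simp add: nn_integral_cmult)
qed

lemma power_DIM_powr:
  assumes "r \<ge> 0"
  shows "ennreal (r ^ (DIM('a::euclidean_space) - 1)) * ennreal (r powr a) =
    ennreal (r powr (real DIM('a) + a - 1))"
\<comment> \<open>At \<open>r = 0\<close> both sides vanish, because \<open>0 powr b = 0\<close> for
  every exponent \<open>b\<close>.\<close>
proof (cases "r = 0")
  case False
  then have "r ^ (DIM('a) - 1) * r powr a = r powr (real (DIM('a) - 1) + a)"
    using assms False by (simp add: powr_add powr_realpow del: One_nat_def)
  also have "real (DIM('a) - 1) + a = real DIM('a) + a - 1"
    by (simp add: of_nat_diff Suc_leI)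
  finally show ?thesis
    using assms by (simp add: ennreal_mult[symmetric] del: One_nat_def)
qed auto

text \<open>In polar form the exponent is \<open>DIM('a) + a - 1\<close>, and the assumption on
  \<open>a\<close> says that it exceeds -1, which is integrability at the origin.\<close>

lemma nn_integral_norm_powr_cball:
  fixes a :: real
  assumes a: "a > - real DIM('a::euclidean_space)" and R: "R \<ge> 0"
  shows "(\<integral>\<^sup>+(x::'a). ennreal (norm x powr a) * indicator {..R} (norm x) \<partial>lborel) =
    ennreal (real DIM('a) * unit_ball_vol (real DIM('a)) *
      (R powr (real DIM('a) + a) / (real DIM('a) + a)))"
proof -
  have "(\<integral>\<^sup>+r. ennreal (r ^ (DIM('a) - 1)) * (ennreal (r powr a) * indicator {..R} r) * indicator {0..} r \<partial>lborel)
    = (\<integral>\<^sup>+r. ennreal (r powr (real DIM('a) + a - 1)) * indicator {0..R} r \<partial>lborel)"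
    by (intro nn_integral_cong) (auto simp: indicator_def power_DIM_powr simp del: One_nat_def)
  also have "\<dots> = ennreal (R powr (real DIM('a) + a) / (real DIM('a) + a))"
    using has_integral_powr_from_0[of "real DIM('a) + a - 1" R] a R
    by (intro nn_integral_has_integral_lebesgue') auto
  finally show ?thesis
    using a R by (subst nn_integral_radial) (auto simp: ennreal_mult''[symmetric] simp del: One_nat_def)
qed

text \<open>Here the radial exponent is below -1, which is integrability at infinity; the
  denominator \<open>- (DIM('a) + a)\<close> is positive.\<close>

lemma nn_integral_norm_powr_outside:
  fixes a :: real
  assumes a: "a < - real DIM('a::euclidean_space)" and R: "R > 0"
  shows "(\<integral>\<^sup>+(x::'a). ennreal (norm x powr a) * indicator {R..} (norm x) \<partial>lborel) =
    ennreal (real DIM('a) * unit_ball_vol (real DIM('a)) *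
      (R powr (real DIM('a) + a) / - (real DIM('a) + a)))"
proof -
  have "(\<integral>\<^sup>+r. ennreal (r ^ (DIM('a) - 1)) * (ennreal (r powr a) * indicator {R..} r) * indicator {0..} r \<partial>lborel)
    = (\<integral>\<^sup>+r. ennreal (r powr (real DIM('a) + a - 1)) * indicator {R..} r \<partial>lborel)"
    using R by (intro nn_integral_cong) (auto simp: indicator_def power_DIM_powr simp del: One_nat_def)
  also have "\<dots> = ennreal (R powr (real DIM('a) + a) / - (real DIM('a) + a))"
    using has_integral_powr_to_inf[of "real DIM('a) + a - 1" R] a R
    by (intro nn_integral_has_integral_lebesgue') (auto simp del: minus_add_distrib)
  finally show ?thesis
    using a R by (subst nn_integral_radial) (auto simp: ennreal_mult''[symmetric] zero_le_divide_iff simp del: One_nat_def)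
qed

section \<open>Gaussian-weighted powers of the norm and their scaling in time\<close>

text \<open>For positive \<open>y\<close> the exponential dominates each single term of its power
  series.\<close>

lemma exp_minus_le_fact_div_power:
  assumes "y > (0::real)"
  shows "exp (- y) \<le> fact m / y ^ m"
proof -
  have "y ^ m / fact m \<le> exp y"
    using sum_le_suminf[OF summable_exp_generic[of y], of "{m}"] assms
    by (simp add: exp_def divide_inverse mult.commute)
  then show ?thesis
    using assms by (simp add: exp_minus field_simps)
qed

text \<open>
  The integral is split at \<open>\<bar>x\<bar> = t powr (-1/2)\<close>, where
  \<open>exp (-y) \<le> n! / y\<^sup>n\<close> makes the outer part a convergent power integral.
\<close>

lemma nn_integral_gauss_norm_powr_le:
  fixes a :: real
  assumes a: "a > - real DIM('a::euclidean_space)" "a \<le> 0"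
  obtains K where "K > 0" and "\<And>t. t > 0 \<Longrightarrow>
    (\<integral>\<^sup>+(x::'a). ennreal (exp (- ((norm x)\<^sup>2 * t / 4)) * norm x powr a) \<partial>lborel)
      \<le> ennreal (K * t powr (- ((real DIM('a) + a) / 2)))"
proof
  define n where "n = DIM('a)"
  define V where "V = real n * unit_ball_vol (real n)"
  \<comment> \<open>The first summand comes from the ball with exponent \<open>a\<close>, the second
    from its exterior with exponent \<open>a - 2 n\<close>, for which
    \<open>n + (a - 2 n) = a - n\<close>.\<close>
  define K where "K = V / (real n + a) + fact n * 4 ^ n * (V / (real n - a))"
  have n: "n > 0" "real n + a > 0" "real n - a > 0" using a by (auto simp: n_def)
  have V: "V > 0" using n by (simp add: V_def)
  show "K > 0" using n V by (auto simp: K_def intro!: add_pos_pos mult_pos_pos)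
  fix t :: real assume t: "t > 0"
  define R where "R = t powr (-1/2)"
  have R: "R > 0" using t by (simp add: R_def)
  have Rp: "R powr b = t powr (- (b / 2))" for b by (simp add: R_def powr_powr)
  \<comment> \<open>Inside the radius the exponential is bounded by 1; outside, \<open>m = n\<close>
    in the exponential bound lowers the exponent by \<open>2 n\<close>. Both indicators include
    \<open>R\<close>, which only enlarges the right side.\<close>
  have pw: "exp (- (r\<^sup>2 * t / 4)) * r powr a \<le> r powr a * indicator {..R} r
      + fact n * 4 ^ n * t powr (- real n) * (r powr (a - 2 * real n) * indicator {R..} r)"
    if r: "r \<ge> 0" for r
  proof (cases "r = 0 \<or> r < R")
    case True
    have "exp (- (r\<^sup>2 * t / 4)) * r powr a \<le> 1 * r powr a"
      using t by (intro mult_right_mono) auto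
    with True R show ?thesis by (auto simp: indicator_def)
  next
    case False
    then have r: "r > 0" "r \<ge> R" using r by auto
    have "exp (- (r\<^sup>2 * t / 4)) \<le> fact n / (r\<^sup>2 * t / 4) ^ n"
      using r t by (intro exp_minus_le_fact_div_power) auto
    also have "\<dots> = fact n * 4 ^ n * t powr (- real n) * r powr (- 2 * real n)"
    proof -
      have "r powr (- 2 * real n) = inverse (r powr real (2 * n))"
        by (simp add: powr_minus)
      also have "\<dots> = inverse ((r\<^sup>2) ^ n)"
        using r by (simp only: powr_realpow power_mult)
      finally have "r powr (- 2 * real n) = inverse ((r\<^sup>2) ^ n)" .
      moreover have "t powr (- real n) = inverse (t ^ n)"
        using t by (simp add: powr_minus powr_realpow)
      moreover have "u / (x * y / z) = u * z * inverse y * inverse x" for u x y z :: real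
        by (simp add: divide_inverse)
      ultimately show ?thesis
        by (simp only: power_divide power_mult_distrib)
    qed
    finally have "exp (- (r\<^sup>2 * t / 4)) * r powr a
      \<le> fact n * 4 ^ n * t powr (- real n) * r powr (- 2 * real n) * r powr a"
      by (rule mult_right_mono) auto
    also have "\<dots> = fact n * 4 ^ n * t powr (- real n) * r powr (a - 2 * real n)"
    proof -
      have "a - 2 * real n = - 2 * real n + a" by simp
      then show ?thesis by (simp only: powr_add mult.assoc)
    qed
    finally show ?thesis using r by (auto simp: indicator_def intro!: add_increasing)
  qed
  have "(\<integral>\<^sup>+(x::'a). ennreal (exp (- ((norm x)\<^sup>2 * t / 4)) * norm x powr a) \<partial>lborel)
    \<le> (\<integral>\<^sup>+(x::'a). ennreal (norm x powr a) * indicator {..R} (norm x)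
      + ennreal (fact n * 4 ^ n * t powr (- real n)) *
        (ennreal (norm x powr (a - 2 * real n)) * indicator {R..} (norm x)) \<partial>lborel)"
  proof (intro nn_integral_mono)
    fix x :: 'a
    have "ennreal (exp (- ((norm x)\<^sup>2 * t / 4)) * norm x powr a) \<le> ennreal (norm x powr a * indicator {..R} (norm x)
      + fact n * 4 ^ n * t powr (- real n) * (norm x powr (a - 2 * real n) * indicator {R..} (norm x)))"
      using pw[of "norm x"] by (intro ennreal_leI) simp
    also have "\<dots> = ennreal (norm x powr a) * indicator {..R} (norm x)
      + ennreal (fact n * 4 ^ n * t powr (- real n)) *
        (ennreal (norm x powr (a - 2 * real n)) * indicator {R..} (norm x))"
      by (subst ennreal_plus) (auto simp: ennreal_mult ennreal_indicator)
    finally show "ennreal (exp (- ((norm x)\<^sup>2 * t / 4)) * norm x powr a) \<le> \<dots>" .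
  qed
  also have "\<dots> = ennreal (V * (R powr (real n + a) / (real n + a))) +
     ennreal (fact n * 4 ^ n * t powr (- real n)) * ennreal (V * (R powr (a - real n) / (real n - a)))"
  proof -
    have "(\<integral>\<^sup>+(x::'a). ennreal (norm x powr a) * indicator {..R} (norm x) \<partial>lborel)
        = ennreal (V * (R powr (real n + a) / (real n + a)))"
      using nn_integral_norm_powr_cball[where 'a = 'a, OF a(1), of R] R by (simp add: V_def n_def)
    moreover have "(\<integral>\<^sup>+(x::'a). ennreal (norm x powr (a - 2 * real n)) * indicator {R..} (norm x) \<partial>lborel)
        = ennreal (V * (R powr (a - real n) / (real n - a)))"
    proof -
      have less: "a - 2 * real n < - real DIM('a)" using n by (simp add: n_def)
      have eq: "real n + (a - 2 * real n) = a - real n" by simp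
      show ?thesis
        using nn_integral_norm_powr_outside[OF less R]
        unfolding n_def[symmetric] V_def[symmetric] eq minus_diff_eq .
    qed
    moreover have "(\<integral>\<^sup>+x. f x + k * h x \<partial>lborel) = integral\<^sup>N lborel f + k * integral\<^sup>N lborel h"
      if "f \<in> borel_measurable borel" "h \<in> borel_measurable borel" for f h :: "'a \<Rightarrow> ennreal" and k
      using that by (simp add: nn_integral_add nn_integral_cmult)
    from this[of "\<lambda>x. ennreal (norm x powr a) * indicator {..R} (norm x)"
        "\<lambda>x. ennreal (norm x powr (a - 2 * real n)) * indicator {R..} (norm x)"]
    have "(\<integral>\<^sup>+(x::'a). ennreal (norm x powr a) * indicator {..R} (norm x)
        + k * (ennreal (norm x powr (a - 2 * real n)) * indicator {R..} (norm x)) \<partial>lborel)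
      = (\<integral>\<^sup>+(x::'a). ennreal (norm x powr a) * indicator {..R} (norm x) \<partial>lborel)
        + k * (\<integral>\<^sup>+(x::'a). ennreal (norm x powr (a - 2 * real n)) * indicator {R..} (norm x) \<partial>lborel)"
      for k by measurable
    ultimately show ?thesis by (simp only:)
  qed
  also have "\<dots> = ennreal (V * (R powr (real n + a) / (real n + a)) +
     fact n * 4 ^ n * t powr (- real n) * (V * (R powr (a - real n) / (real n - a))))"
    using n V by (simp only: ennreal_mult'' ennreal_plus zero_le_mult_iff zero_le_divide_iff
        powr_ge_zero less_imp_le zero_le_power fact_ge_zero zero_le_numeral simp_thms)
  also have "V * (R powr (real n + a) / (real n + a)) +
     fact n * 4 ^ n * t powr (- real n) * (V * (R powr (a - real n) / (real n - a)))
     = K * t powr (- ((real n + a) / 2))"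
  \<comment> \<open>With \<open>R = t powr (-1/2)\<close> both pieces scale alike: the inner one
    directly, the outer one after its factor \<open>t powr (- n)\<close> is merged with the power of
    \<open>R\<close>.\<close>
  proof -
    have "- ((real n + a) / 2) = - real n + - ((a - real n) / 2)" by (simp add: field_simps)
    then have "t powr (- ((real n + a) / 2)) = t powr (- real n) * t powr (- ((a - real n) / 2))"
      by (simp only: powr_add)
    then have "fact n * 4 ^ n * t powr (- real n) * (V * (R powr (a - real n) / (real n - a)))
        = fact n * 4 ^ n * (V / (real n - a)) * t powr (- ((real n + a) / 2))"
      unfolding Rp by simp
    then show ?thesis
      by (simp add: Rp K_def distrib_right)
  qed
  finally show "(\<integral>\<^sup>+(x::'a). ennreal (exp (- ((norm x)\<^sup>2 * t / 4)) * norm x powr a) \<partial>lborel)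
      \<le> ennreal (K * t powr (- ((real DIM('a) + a) / 2)))"
    by (simp add: n_def)
qed

section \<open>Boundedness and continuity of the Fourier transform\<close>

text \<open>The kernel has modulus 1. The bound is applied twice: to \<open>g\<close> at low
  frequencies, and to the multiplied transform to bound the output of the operator.\<close>

lemma norm_fourier_le:
  fixes g :: "real ^ 'n \<Rightarrow> complex"
  shows "norm (fourier g \<xi>) \<le> (2 * pi) powr (- real CARD('n) / 2) * L1_norm g"
  unfolding fourier_def L1_norm_def
  by (auto intro!: mult_left_mono order_trans[OF integral_norm_bound] simp: norm_mult)

text \<open>Dominated convergence with majorant \<open>norm (g x)\<close>. Continuity supplies the
  Borel measurability of transforms in the later integrals.\<close>

lemma continuous_fourier:
  fixes g :: "real ^ 'n \<Rightarrow> complex"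
  assumes g: "integrable lebesgue g"
  shows "continuous_on UNIV (fourier g)"
proof -
  have [measurable]: "g \<in> borel_measurable lebesgue" using g by auto
  have [measurable]: "(\<lambda>x. cis (- (x \<bullet> \<xi>))) \<in> borel_measurable lebesgue" for \<xi> :: "real ^ 'n"
    by (intro measurable_completion) (auto intro!: borel_measurable_continuous_onI continuous_intros)
  have "(\<lambda>k. LINT x|lebesgue. cis (- (x \<bullet> X k)) * g x) \<longlonglongrightarrow> (LINT x|lebesgue. cis (- (x \<bullet> \<xi>)) * g x)"
    if "X \<longlonglongrightarrow> \<xi>" for X and \<xi> :: "real ^ 'n"
    using that
    by (intro integral_dominated_convergence[where w = "\<lambda>x. norm (g x)"])
       (auto simp: norm_mult g intro!: tendsto_intros isCont_tendsto_compose[of _ cis] continuous_intros)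
  then show ?thesis
    unfolding continuous_on_sequentially fourier_def comp_def
    by (auto intro!: tendsto_intros)
qed

text \<open>Reduces the inverse transform to the two preceding facts by reflection.\<close>

lemma inv_fourier_eq_fourier: "inv_fourier F x = fourier F (- x)"
  by (simp add: inv_fourier_def fourier_def inner_commute)

section \<open>Pointwise bounds of the symbol\<close>

lemma Lambda_symbol_measurable [measurable]:
  "(Lambda_symbol \<theta> t :: real ^ 'n \<Rightarrow> real) \<in> borel_measurable borel"
  unfolding Lambda_symbol_def S_symbol_def by measurable

text \<open>The factor \<open>1 + (norm \<xi>)\<^sup>2\<close> cancels against the resolvent, the
  division by \<open>(norm \<xi>)\<^sup>2\<close> lowers the power by 2, and the sine is at most 1
  in modulus. The origin is excluded because \<open>powr\<close> gives 0 there, while the symbol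
  equals \<open>t\<close> for \<open>\<theta> = 0\<close>.\<close>

lemma abs_Lambda_symbol_le:
  fixes \<xi> :: "real ^ 'n"
  assumes "\<xi> \<noteq> 0"
  shows "\<bar>Lambda_symbol \<theta> t \<xi>\<bar> \<le> exp (- ((norm \<xi>)\<^sup>2 * t / (2 * (1 + (norm \<xi>)\<^sup>2)))) *
    (2 / sqrt (3 + 4 * (norm \<xi>)\<^sup>2)) * norm \<xi> powr (2 * \<theta> - 2)"
proof -
  define r where "r = norm \<xi>"
  have r: "r > 0" using assms by (simp add: r_def)
  let ?E = "exp (- (r\<^sup>2 * t / (2 * (1 + r\<^sup>2))))"
  let ?s = "sin (r\<^sup>2 * sqrt (3 + 4 * r\<^sup>2) * t / (2 * (1 + r\<^sup>2)))"
  \<comment> \<open>Since \<open>r > 0\<close>, one formula covers both branches of the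
    definition.\<close>
  have th: "(if \<theta> = 0 then 1 else r powr (2 * \<theta>)) = r\<^sup>2 * r powr (2 * \<theta> - 2)"
    using r by (auto simp: powr_diff)
  have p: "1 + r\<^sup>2 > 0" "sqrt (3 + 4 * r\<^sup>2) > 0"
    by (auto intro: add_pos_nonneg)
  have "Lambda_symbol \<theta> t \<xi> = ?E * (2 / sqrt (3 + 4 * r\<^sup>2)) * r powr (2 * \<theta> - 2) * ?s"
    unfolding Lambda_symbol_def S_symbol_def r_def[symmetric] th
    using assms r p by (simp add: divide_simps)
  then have "\<bar>Lambda_symbol \<theta> t \<xi>\<bar> = ?E * (2 / sqrt (3 + 4 * r\<^sup>2)) * r powr (2 * \<theta> - 2) * \<bar>?s\<bar>"
    using p by (simp add: abs_mult)
  also have "\<dots> \<le> ?E * (2 / sqrt (3 + 4 * r\<^sup>2)) * r powr (2 * \<theta> - 2) * 1"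
    using p by (intro mult_left_mono) auto
  finally show ?thesis by (simp add: r_def)
qed

text \<open>On the unit ball \<open>2 * (1 + (norm \<xi>)\<^sup>2)\<close> is at most 4, which gives
  the Gaussian, and the square root is at least 1.\<close>

lemma abs_Lambda_symbol_le_low:
  fixes \<xi> :: "real ^ 'n"
  assumes "\<xi> \<noteq> 0" "norm \<xi> \<le> 1" "t > 0"
  shows "\<bar>Lambda_symbol \<theta> t \<xi>\<bar> \<le> 2 * (exp (- ((norm \<xi>)\<^sup>2 * t / 4)) * norm \<xi> powr (2 * \<theta> - 2))"
proof -
  have r: "(norm \<xi>)\<^sup>2 \<le> 1" using assms by (simp add: power_le_one)
  have "(norm \<xi>)\<^sup>2 * t / 4 \<le> (norm \<xi>)\<^sup>2 * t / (2 * (1 + (norm \<xi>)\<^sup>2))"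
    using r assms by (intro divide_left_mono) (auto intro!: mult_pos_pos add_pos_nonneg)
  moreover have "2 / sqrt (3 + 4 * (norm \<xi>)\<^sup>2) \<le> 2 / 1"
    by (intro divide_left_mono) (auto intro: add_pos_nonneg)
  ultimately have "exp (- ((norm \<xi>)\<^sup>2 * t / (2 * (1 + (norm \<xi>)\<^sup>2)))) * (2 / sqrt (3 + 4 * (norm \<xi>)\<^sup>2))
      * norm \<xi> powr (2 * \<theta> - 2) \<le> exp (- ((norm \<xi>)\<^sup>2 * t / 4)) * 2 * norm \<xi> powr (2 * \<theta> - 2)"
    by (intro mult_mono) auto
  with abs_Lambda_symbol_le[OF assms(1), of \<theta> t] show ?thesis by simp
qed

text \<open>Outside the unit ball \<open>(norm \<xi>)\<^sup>2 / (1 + (norm \<xi>)\<^sup>2)\<close>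
  is at least 1/2, whence the rate \<open>t / 4\<close>. The square root is at least
  \<open>2 * norm \<xi>\<close>, which gains one more power of decay.\<close>

lemma abs_Lambda_symbol_le_high:
  fixes \<xi> :: "real ^ 'n"
  assumes "norm \<xi> \<ge> 1" "t > 0"
  shows "\<bar>Lambda_symbol \<theta> t \<xi>\<bar> \<le> exp (- t / 4) * norm \<xi> powr (2 * \<theta> - 3)"
proof -
  have r: "(norm \<xi>)\<^sup>2 \<ge> 1" and nz: "\<xi> \<noteq> 0" using assms by auto
  have "t * (1 + (norm \<xi>)\<^sup>2) \<le> t * (2 * (norm \<xi>)\<^sup>2)"
    using r assms by (intro mult_left_mono) auto
  then have "t / 4 \<le> (norm \<xi>)\<^sup>2 * t / (2 * (1 + (norm \<xi>)\<^sup>2))"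
    using r by (simp add: field_simps)
  moreover have "2 / sqrt (3 + 4 * (norm \<xi>)\<^sup>2) \<le> 2 / (2 * norm \<xi>)"
    using assms by (intro divide_left_mono real_le_rsqrt) (auto simp: power_mult_distrib intro!: mult_pos_pos add_pos_nonneg)
  ultimately have "exp (- ((norm \<xi>)\<^sup>2 * t / (2 * (1 + (norm \<xi>)\<^sup>2)))) * (2 / sqrt (3 + 4 * (norm \<xi>)\<^sup>2))
      * norm \<xi> powr (2 * \<theta> - 2) \<le> exp (- t / 4) * (1 / norm \<xi>) * norm \<xi> powr (2 * \<theta> - 2)"
    using assms by (intro mult_mono) auto
  also have "\<dots> = exp (- t / 4) * norm \<xi> powr (2 * \<theta> - 3)"
    using assms nz by (simp add: powr_diff power2_eq_square power3_eq_cube)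
  finally show ?thesis
    using abs_Lambda_symbol_le[OF nz, of \<theta> t] by simp
qed

section \<open>High frequencies against the Sobolev norm\<close>

text \<open>For \<open>r \<ge> 1\<close> the base lies between \<open>r\<^sup>2\<close> and
  \<open>2 * r\<^sup>2\<close>; the sign of \<open>p\<close> decides which comparison is used, and
  the absolute value covers both.\<close>

lemma one_plus_square_powr_le:
  fixes r p :: real
  assumes "r \<ge> 1"
  shows "(1 + r\<^sup>2) powr p \<le> 2 powr \<bar>p\<bar> * r powr (2 * p)"
proof (cases "p \<ge> 0")
  case True
  have "(1 + r\<^sup>2) powr p \<le> (2 * r\<^sup>2) powr p"
    using True assms by (intro powr_mono2) auto
  then show ?thesis using True assms by (simp add: powr_mult powr_powr flip: powr_numeral)
next
  case False
  have "(1 + r\<^sup>2) powr p \<le> (r\<^sup>2) powr p"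
    using False assms by (intro powr_mono2') auto
  also have "\<dots> = 1 * r powr (2 * p)"
    using assms by (simp add: powr_powr flip: powr_numeral)
  also have "\<dots> \<le> 2 powr \<bar>p\<bar> * r powr (2 * p)"
    by (intro mult_right_mono) (auto simp: ge_one_powr_ge_zero)
  finally show ?thesis .
qed

text \<open>Cauchy-Schwarz after inserting \<open>(1 + (norm \<xi>)\<^sup>2) powr (- s / 2)\<close>
  and its reciprocal. Working with extended nonnegative integrals makes finiteness part of the
  conclusion.\<close>

lemma nn_integral_high_frequency_le:
  fixes s \<theta> :: real
  assumes s: "s > (real CARD('n::finite) + 4 * \<theta> - 6) / 2"
  obtains K where "K > 0" and "\<And>g :: real ^ 'n \<Rightarrow> complex. g \<in> L1_Hs s \<Longrightarrow>
    (\<integral>\<^sup>+\<xi>. ennreal (norm \<xi> powr (2 * \<theta> - 3) * indicator {1..} (norm \<xi>) * norm (fourier g \<xi>)) \<partial>lborel)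
      \<le> ennreal (K * Hs_norm s g)"
proof
  \<comment> \<open>Growth exponent of the squared weight \<open>?u\<close> below; the assumption on
    \<open>s\<close> says exactly \<open>a < - CARD('n)\<close>. The number \<open>A\<close> is then
    the integral of \<open>norm \<xi> powr a\<close> over \<open>norm \<xi> \<ge> 1\<close>.\<close>
  define a where "a = 4 * \<theta> - 6 - 2 * s"
  define A where "A = real CARD('n) * unit_ball_vol (real CARD('n)) / - (real CARD('n) + a)"
  define K where "K = sqrt (2 powr \<bar>s\<bar> * A)"
  have a: "a < - real CARD('n)" using s by (simp add: a_def field_simps)
  have A: "A > 0" using a by (auto simp: A_def intro!: divide_pos_pos)
  show K: "K > 0" using A by (simp add: K_def)
  fix g :: "real ^ 'n \<Rightarrow> complex" assume g: "g \<in> L1_Hs s"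
  have [measurable]: "fourier g \<in> borel_measurable borel"
    using g by (intro borel_measurable_continuous_onI continuous_fourier) (auto simp: L1_Hs_def)
  let ?u = "\<lambda>\<xi>::real^'n. norm \<xi> powr (2 * \<theta> - 3) * indicator {1..} (norm \<xi>) * (1 + (norm \<xi>)\<^sup>2) powr (- s / 2)"
  let ?v = "\<lambda>\<xi>. (1 + (norm \<xi>)\<^sup>2) powr (s / 2) * norm (fourier g \<xi>)"
  let ?I = "\<integral>\<^sup>+(\<xi>::real^'n). ennreal (norm \<xi> powr (2 * \<theta> - 3) * indicator {1..} (norm \<xi>) * norm (fourier g \<xi>)) \<partial>lborel"
  have pos: "1 + (norm \<xi>)\<^sup>2 > 0" for \<xi> :: "real ^ 'n" by (auto intro: add_pos_nonneg)
  have uv: "norm \<xi> powr (2 * \<theta> - 3) * indicator {1..} (norm \<xi>) * norm (fourier g \<xi>) = ?u \<xi> * ?v \<xi>" for \<xi>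
  proof -
    have "(1 + (norm \<xi>)\<^sup>2) powr (- s / 2) * (1 + (norm \<xi>)\<^sup>2) powr (s / 2) = 1"
      using pos[of \<xi>] by (simp add: powr_add[symmetric])
    then show ?thesis by (simp add: mult.assoc)
  qed
  have V: "(\<integral>\<^sup>+\<xi>. (ennreal (?v \<xi>))\<^sup>2 \<partial>lborel) = ennreal ((Hs_norm s g)\<^sup>2)"
  proof -
    have "(?v \<xi>)\<^sup>2 = (1 + (norm \<xi>)\<^sup>2) powr s * (norm (fourier g \<xi>))\<^sup>2" for \<xi>
      using pos[of \<xi>] by (simp add: power_mult_distrib power2_eq_square powr_add[symmetric])
    then have "(\<integral>\<^sup>+\<xi>. (ennreal (?v \<xi>))\<^sup>2 \<partial>lborel)
        = (\<integral>\<^sup>+\<xi>. ennreal ((1 + (norm \<xi>)\<^sup>2) powr s * (norm (fourier g \<xi>))\<^sup>2) \<partial>lebesgue)"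
      by (simp add: ennreal_power nn_integral_completion)
    \<comment> \<open>Membership in \<open>L1_Hs s\<close> rules out the default value 0 of the
      Bochner integral in \<open>Hs_norm\<close>.\<close>
    also have "\<dots> = ennreal (LINT \<xi>|lebesgue. (1 + (norm \<xi>)\<^sup>2) powr s * (norm (fourier g \<xi>))\<^sup>2)"
      using g by (intro nn_integral_eq_integral) (auto simp: L1_Hs_def)
    finally show ?thesis by (simp add: Hs_norm_def)
  qed
  have "(\<integral>\<^sup>+\<xi>. (ennreal (?u \<xi>))\<^sup>2 \<partial>lborel)
      \<le> (\<integral>\<^sup>+(\<xi>::real^'n). ennreal (2 powr \<bar>s\<bar>) * (ennreal (norm \<xi> powr a) * indicator {1..} (norm \<xi>)) \<partial>lborel)"
  proof (intro nn_integral_mono)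
    fix \<xi> :: "real ^ 'n"
    show "(ennreal (?u \<xi>))\<^sup>2 \<le> ennreal (2 powr \<bar>s\<bar>) * (ennreal (norm \<xi> powr a) * indicator {1..} (norm \<xi>))"
    proof (cases "norm \<xi> \<ge> 1")
      case True
      have "(?u \<xi>)\<^sup>2 = norm \<xi> powr (4 * \<theta> - 6) * (1 + (norm \<xi>)\<^sup>2) powr (- s)"
      proof -
        have sq: "(x powr p)\<^sup>2 = x powr (2 * p)" for x p :: real
          by (simp only: power2_eq_square mult_2 powr_add)
        have "2 * (2 * \<theta> - 3) = 4 * \<theta> - 6" by simp
        then show ?thesis using True by (simp add: power_mult_distrib sq)
      qed
      also have "\<dots> \<le> norm \<xi> powr (4 * \<theta> - 6) * (2 powr \<bar>s\<bar> * norm \<xi> powr (- 2 * s))"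
        using one_plus_square_powr_le[OF True, of "- s"] by (intro mult_left_mono) auto
      also have "\<dots> = 2 powr \<bar>s\<bar> * norm \<xi> powr a"
      proof -
        have "a = (4 * \<theta> - 6) + (- 2 * s)" by (simp add: a_def)
        then show ?thesis by (simp only: powr_add mult.left_commute)
      qed
      finally have "ennreal ((?u \<xi>)\<^sup>2) \<le> ennreal (2 powr \<bar>s\<bar> * norm \<xi> powr a)" by (rule ennreal_leI)
      then show ?thesis using True by (simp add: ennreal_power ennreal_mult''[symmetric])
    qed simp
  qed
  also have "\<dots> = ennreal (2 powr \<bar>s\<bar> * A)"
  proof -
    have "(\<integral>\<^sup>+(\<xi>::real^'n). ennreal (norm \<xi> powr a) * indicator {1..} (norm \<xi>) \<partial>lborel) = ennreal A"
      using a by (subst nn_integral_norm_powr_outside) (auto simp: A_def)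
    then show ?thesis
      using A by (subst nn_integral_cmult) (auto simp: ennreal_mult)
  qed
  finally have U: "(\<integral>\<^sup>+\<xi>. (ennreal (?u \<xi>))\<^sup>2 \<partial>lborel) \<le> ennreal (2 powr \<bar>s\<bar> * A)" .
  have "?I\<^sup>2 = (\<integral>\<^sup>+\<xi>. ennreal (?u \<xi>) * ennreal (?v \<xi>) \<partial>lborel)\<^sup>2"
    by (simp add: uv ennreal_mult)
  also have "\<dots> \<le> (\<integral>\<^sup>+\<xi>. (ennreal (?u \<xi>))\<^sup>2 \<partial>lborel) * (\<integral>\<^sup>+\<xi>. (ennreal (?v \<xi>))\<^sup>2 \<partial>lborel)"
    by (intro Cauchy_Schwarz_nn_integral) measurable
  also have "\<dots> \<le> ennreal (2 powr \<bar>s\<bar> * A) * ennreal ((Hs_norm s g)\<^sup>2)"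
    unfolding V by (rule mult_right_mono[OF U]) simp
  also have "\<dots> = (ennreal (K * Hs_norm s g))\<^sup>2"
    using A by (simp add: K_def ennreal_mult[symmetric] ennreal_power Hs_norm_def power_mult_distrib)
  finally have le: "?I\<^sup>2 \<le> (ennreal (K * Hs_norm s g))\<^sup>2" .
  show "?I \<le> ennreal (K * Hs_norm s g)"
  \<comment> \<open>Taking the square root: \<open>?I\<close> is not yet known to be finite, but an
    infinite value would have an infinite square, against \<open>le\<close>.\<close>
  proof (cases ?I)
    case (real i)
    have nonneg: "K * Hs_norm s g \<ge> 0" using K by (simp add: Hs_norm_def)
    have "ennreal (i\<^sup>2) \<le> ennreal ((K * Hs_norm s g)\<^sup>2)"
      using le unfolding real(2) by (simp only: ennreal_power real(1) nonneg)
    then have "i\<^sup>2 \<le> (K * Hs_norm s g)\<^sup>2"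
      by (simp only: ennreal_le_iff zero_le_power2)
    then have "i \<le> K * Hs_norm s g"
      using nonneg by (rule power2_le_imp_le)
    then show ?thesis unfolding real(2) by (rule ennreal_leI)
  next
    case top
    then have "?I\<^sup>2 = top" by (simp only: power2_eq_square ennreal_top_mult ennreal_top_neq_zero if_False)
    moreover have "(ennreal (K * Hs_norm s g))\<^sup>2 \<noteq> top"
      by (simp only: power2_eq_square ennreal_mult_eq_top_iff ennreal_neq_top simp_thms)
    ultimately show ?thesis using le by (simp only: top_unique)
  qed
qed

section \<open>Combination of the two frequency ranges\<close>

theorem lemma3p2:
  fixes \<theta> s :: real
  assumes "CARD('n::finite) \<le> 2 \<Longrightarrow> \<theta> \<in> {(2 - real CARD('n)) / 2 <.. 1}"
    and "CARD('n) \<ge> 3 \<Longrightarrow> \<theta> \<in> {0..1}"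
    and "s > (real CARD('n) + 4 * \<theta> - 6) / 2"
  shows "\<exists>C>0. \<forall>g \<in> (L1_Hs s :: (real ^ 'n \<Rightarrow> complex) set). \<forall>t>0.
           multiplier_defined (Lambda_symbol \<theta> t) g \<and>
           Linf_norm (Lambda_op \<theta> t g)
             \<le> ereal (C * t powr (- ((real CARD('n) + 2 * (\<theta> - 1)) / 2)) * L1_norm g
                      + C * exp (- t / 4) * Hs_norm s g)"
proof -
  define a where "a = 2 * \<theta> - 2"
  define c where "c = (2 * pi) powr (- real CARD('n) / 2)"
  have c: "c > 0" by (simp add: c_def)
  \<comment> \<open>For dimension at most 2 the lower bound on \<theta> is exactly
    \<open>a > - CARD('n)\<close>; from dimension 3 on, \<open>\<theta> \<ge> 0\<close> gives
    \<open>a \<ge> -2\<close>, which suffices.\<close>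
  have a: "a > - real CARD('n)" "a \<le> 0"
    using assms(1,2) by (cases "CARD('n) \<le> 2"; auto simp: a_def field_simps)+
  obtain K1 where K1: "K1 > 0" and low: "\<And>t. t > 0 \<Longrightarrow>
      (\<integral>\<^sup>+(\<xi>::real^'n). ennreal (exp (- ((norm \<xi>)\<^sup>2 * t / 4)) * norm \<xi> powr a) \<partial>lborel)
        \<le> ennreal (K1 * t powr (- ((real CARD('n) + a) / 2)))"
    using nn_integral_gauss_norm_powr_le[where 'a = "real ^ 'n", of a] a by auto
  obtain K2 where K2: "K2 > 0" and high: "\<And>g :: real ^ 'n \<Rightarrow> complex. g \<in> L1_Hs s \<Longrightarrow>
      (\<integral>\<^sup>+\<xi>. ennreal (norm \<xi> powr (2 * \<theta> - 3) * indicator {1..} (norm \<xi>) * norm (fourier g \<xi>)) \<partial>lborel)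
        \<le> ennreal (K2 * Hs_norm s g)"
    using nn_integral_high_frequency_le[OF assms(3)] by blast
  \<comment> \<open>One \<open>c\<close> comes from the inverse transform, the other from bounding
    \<open>fourier g\<close> by the \<open>L1_norm\<close>. The sum dominates the coefficients of
    both terms, and \<open>C\<close> is fixed before \<open>g\<close> and \<open>t\<close>.\<close>
  define C where "C = c * (2 * c * K1 + K2)"
  show ?thesis
  proof (intro exI[of _ C] conjI ballI allI impI)
    show "C > 0" using c K1 K2 by (auto simp: C_def intro!: mult_pos_pos add_pos_pos)
    fix g :: "real ^ 'n \<Rightarrow> complex" and t :: real
    assume g: "g \<in> L1_Hs s" and t: "t > 0"
    have gi: "integrable lebesgue g" using g by (simp add: L1_Hs_def)
    have [measurable]: "fourier g \<in> borel_measurable borel"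
      using gi by (intro borel_measurable_continuous_onI continuous_fourier)
    define F where "F = (\<lambda>\<xi>. complex_of_real (Lambda_symbol \<theta> t \<xi>) * fourier g \<xi>)"
    have F_meas [measurable]: "F \<in> borel_measurable borel" unfolding F_def by measurable
    define T where "T = t powr (- ((real CARD('n) + a) / 2))"
    define B where "B = 2 * c * L1_norm g * (K1 * T) + exp (- t / 4) * (K2 * Hs_norm s g)"
    have L1: "L1_norm g \<ge> 0" and Hs: "Hs_norm s g \<ge> 0" and T: "T \<ge> 0"
      by (auto simp: L1_norm_def Hs_norm_def T_def)
    have B: "B \<ge> 0" using L1 Hs T c K1 K2 by (auto simp: B_def)
    \<comment> \<open>The low-frequency majorant carries no cutoff: it is nonnegative, so adding it
      for \<open>norm \<xi> \<ge> 1\<close> is harmless, and its integral over the whole space is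
      the one already estimated.\<close>
    have pw: "norm (F \<xi>) \<le> 2 * c * L1_norm g * (exp (- ((norm \<xi>)\<^sup>2 * t / 4)) * norm \<xi> powr a)
        + exp (- t / 4) * (norm \<xi> powr (2 * \<theta> - 3) * indicator {1..} (norm \<xi>) * norm (fourier g \<xi>))"
      (is "_ \<le> ?l \<xi> + ?h \<xi>") if "\<xi> \<noteq> 0" for \<xi>
    proof (cases "norm \<xi> \<ge> 1")
      case True
      have "norm (F \<xi>) \<le> exp (- t / 4) * norm \<xi> powr (2 * \<theta> - 3) * norm (fourier g \<xi>)"
        unfolding F_def norm_mult norm_of_real
        by (intro mult_right_mono abs_Lambda_symbol_le_high True t) auto
      then have "norm (F \<xi>) \<le> ?h \<xi>" using True by (simp add: mult.assoc)
      moreover have "?l \<xi> \<ge> 0" using c L1 by simp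
      ultimately show ?thesis by linarith
    next
      case False
      have "norm (F \<xi>) \<le> 2 * (exp (- ((norm \<xi>)\<^sup>2 * t / 4)) * norm \<xi> powr a) * (c * L1_norm g)"
        unfolding F_def norm_mult norm_of_real a_def c_def
        using False that t by (intro mult_mono abs_Lambda_symbol_le_low norm_fourier_le) auto
      then show ?thesis using False by (simp add: algebra_simps)
    qed
    have "(\<integral>\<^sup>+\<xi>. ennreal (norm (F \<xi>)) \<partial>lborel) \<le> (\<integral>\<^sup>+(\<xi>::real^'n).
        ennreal (2 * c * L1_norm g) * ennreal (exp (- ((norm \<xi>)\<^sup>2 * t / 4)) * norm \<xi> powr a)
        + ennreal (exp (- t / 4)) * ennreal (norm \<xi> powr (2 * \<theta> - 3) * indicator {1..} (norm \<xi>) * norm (fourier g \<xi>)) \<partial>lborel)"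
    proof (rule nn_integral_mono_AE)
      \<comment> \<open>The origin, where the pointwise bound may fail, is a null set.\<close>
      have "AE \<xi> in lborel. \<xi> \<noteq> (0 :: real ^ 'n)" by (rule AE_lborel_singleton)
      then show "AE \<xi> in lborel. ennreal (norm (F \<xi>)) \<le>
        ennreal (2 * c * L1_norm g) * ennreal (exp (- ((norm \<xi>)\<^sup>2 * t / 4)) * norm \<xi> powr a)
        + ennreal (exp (- t / 4)) * ennreal (norm \<xi> powr (2 * \<theta> - 3) * indicator {1..} (norm \<xi>) * norm (fourier g \<xi>))"
      proof eventually_elim
        case (elim \<xi>)
        show ?case
          using ennreal_leI[OF pw[OF elim]] c L1 by (simp add: ennreal_mult)
      qed
    qed
    also have "\<dots> \<le> ennreal (2 * c * L1_norm g) * ennreal (K1 * T)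
        + ennreal (exp (- t / 4)) * ennreal (K2 * Hs_norm s g)"
      using low[OF t] high[OF g] unfolding T_def
      by (subst nn_integral_add, measurable, subst nn_integral_cmult, measurable,
          subst nn_integral_cmult, measurable) (intro add_mono mult_left_mono, auto)
    also have "\<dots> = ennreal B"
      using c L1 Hs T K1 K2 by (simp add: B_def ennreal_mult)
    finally have nn: "(\<integral>\<^sup>+\<xi>. ennreal (norm (F \<xi>)) \<partial>lebesgue) \<le> ennreal B"
      by (simp add: nn_integral_completion)
    \<comment> \<open>The finite bound \<open>B\<close> yields integrability, hence that the
      operator is given by an absolutely convergent integral.\<close>
    have Fi: "integrable lebesgue F"
      using nn by (intro integrableI_bounded measurable_completion) (auto simp: less_top[symmetric] top_unique)
    then show "multiplier_defined (Lambda_symbol \<theta> t) g"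
      using gi by (simp add: multiplier_defined_def F_def)
    have "ennreal (L1_norm F) \<le> ennreal B"
      using nn nn_integral_eq_integral[of lebesgue "\<lambda>\<xi>. norm (F \<xi>)"] Fi by (simp add: L1_norm_def)
    then have LF: "L1_norm F \<le> B" using B by simp
    have op: "Lambda_op \<theta> t g = (\<lambda>x. fourier F (- x))"
      by (simp add: Lambda_op_def fourier_multiplier_def F_def[symmetric] inv_fourier_eq_fourier fun_eq_iff)
    have bound: "norm (Lambda_op \<theta> t g x) \<le> C * T * L1_norm g + C * exp (- t / 4) * Hs_norm s g" for x
    proof -
      have "norm (Lambda_op \<theta> t g x) \<le> c * L1_norm F"
        unfolding op c_def by (rule norm_fourier_le)
      also have "\<dots> \<le> c * B" using LF c by simp
      also have "\<dots> = (c * (2 * c * K1)) * (T * L1_norm g) + (c * K2) * (exp (- t / 4) * Hs_norm s g)"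
        by (simp add: B_def algebra_simps)
      also have "\<dots> \<le> C * (T * L1_norm g) + C * (exp (- t / 4) * Hs_norm s g)"
        using c K1 K2 L1 Hs T by (intro add_mono mult_right_mono) (auto simp: C_def)
      finally show ?thesis by (simp add: mult.assoc)
    qed
    have "continuous_on UNIV (\<lambda>x. fourier F (- x))"
      by (rule continuous_on_compose2[OF continuous_fourier[OF Fi]]) (auto intro!: continuous_intros)
    then have [measurable]: "(\<lambda>x. fourier F (- x)) \<in> borel_measurable borel"
      by (rule borel_measurable_continuous_onI)
    \<comment> \<open>Measurability matters here: without it \<open>Linf_norm\<close> would be
      infinite despite the pointwise bound.\<close>
    have "(\<lambda>x. ereal (norm (Lambda_op \<theta> t g x))) \<in> borel_measurable lebesgue"
      unfolding op by (rule measurable_completion) measurable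
    then have "Linf_norm (Lambda_op \<theta> t g)
        \<le> ereal (C * T * L1_norm g + C * exp (- t / 4) * Hs_norm s g)"
      unfolding Linf_norm_def by (rule esssup_I) (simp only: ereal_less_eq bound always_eventually simp_thms)
    also have "T = t powr (- ((real CARD('n) + 2 * (\<theta> - 1)) / 2))"
      unfolding T_def a_def by (simp only: right_diff_distrib mult_1_right)
    finally show "Linf_norm (Lambda_op \<theta> t g)
             \<le> ereal (C * t powr (- ((real CARD('n) + 2 * (\<theta> - 1)) / 2)) * L1_norm g
                      + C * exp (- t / 4) * Hs_norm s g)" .
  qed
qed

end
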